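(* Let $a,b,c\in\mathbb{R}$ with $abc\neq 0$, and let $\{a_n\}_{n\ge 0}$ be a sequence of real numbers with $(a_0,a_1)\neq(0,0)$ satisfying $c\,a_{n+2}+b\,a_{n+1}+a\,a_n=0$ for all $n\ge 0$. For $m\ge 0$ let $P_m(z)=\sum_{n=0}^{m}a_nz^n$. Let $\alpha$ be a zero of largest modulus of the polynomial $at^2+bt+c$. Suppose $ac>0$, $b^2-4ac>0$, $a_0b(a_1c+ba_0)>0$, and $|a_0c|>|(a_1c+ba_0)\alpha|$. Then for all sufficiently large $m$, all the zeros of $P_m(z)$ lie inside the closed ball centered at $0$ with radius $|c|/|a\alpha|$. *)

theory Defs
  imports "HOL-Analysis.Analysis"
begin

end

theory Submission
  imports Defs
begin

text \<open>
  Let \<open>\<beta> = c / (a \<alpha>)\<close> be the other root, so that \<open>\<bar>\<beta>\<bar>\<close> is the radius in question. Both roots are real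
  and of the same sign, and \<open>w n = s n * \<beta> ^ n\<close> satisfies
  \<open>w (n + 2) - w (n + 1) = (\<beta> / \<alpha>) * (w (n + 1) - w n)\<close> with \<open>\<beta> / \<alpha> > 0\<close>. The bound on \<open>s 0 * c\<close> says
  that \<open>w 1 - w 0\<close> has the sign of \<open>w 0\<close>, so up to a common sign \<open>w\<close> is positive and increasing, and
  the Enestroem--Kakeya theorem applies to the polynomial rescaled by \<open>\<beta>\<close>, for every degree \<open>m\<close>.
\<close>

text \<open>Multiplying by \<open>1 - y\<close> telescopes the sum: what stands inside the norm is
  \<open>w 0\<close> plus the terms \<open>(w n - w (n - 1)) * y ^ n\<close> for
  \<open>1 \<le> n \<le> m\<close>. These coefficients are nonnegative and add up to
  \<open>w m\<close>, and each power has norm at most \<open>norm y ^ m\<close>.\<close>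

lemma enestroem_kakeya_bound:
  fixes w :: "nat \<Rightarrow> real" and y :: "'a :: real_normed_field"
  assumes "0 \<le> w 0" and "incseq w" and "1 \<le> norm y"
  shows "norm ((\<Sum>n=0..m. of_real (w n) * y ^ n) * (1 - y) + of_real (w m) * y ^ Suc m)
           \<le> w m * norm y ^ m"
proof (induction m)
  case 0
  then show ?case
    using assms(1) by (simp add: algebra_simps)
next
  case (Suc m)
  let ?X = "\<lambda>m. (\<Sum>n=0..m. of_real (w n) * y ^ n) * (1 - y) + of_real (w m) * y ^ Suc m"
  have nonneg: "0 \<le> w m"
    using assms(1) incseqD[OF assms(2), of 0 m] by simp
  have diff: "0 \<le> w (Suc m) - w m"
    using incseqD[OF assms(2), of m "Suc m"] by simp
  have "?X (Suc m) = ?X m + of_real (w (Suc m) - w m) * y ^ Suc m"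
    by (simp add: algebra_simps)
  then have "norm (?X (Suc m)) \<le> norm (?X m) + norm (of_real (w (Suc m) - w m) * y ^ Suc m)"
    by (simp only: norm_triangle_ineq)
  also have "\<dots> \<le> w m * norm y ^ m + (w (Suc m) - w m) * norm y ^ Suc m"
    using Suc.IH diff by (simp only: norm_mult norm_power norm_of_real abs_of_nonneg add_mono)
  also have "\<dots> \<le> w m * norm y ^ Suc m + (w (Suc m) - w m) * norm y ^ Suc m"
    using nonneg assms(3) by (intro add_right_mono mult_left_mono power_increasing) auto
  finally show ?case
    by (simp add: algebra_simps)
qed

text \<open>At a zero the sum drops out of the bound above, which leaves
  \<open>w m * norm y ^ Suc m \<le> w m * norm y ^ m\<close>. As \<open>w m > 0\<close>, this is
  impossible outside the unit disc.\<close>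

theorem enestroem_kakeya:
  fixes w :: "nat \<Rightarrow> real" and y :: "'a :: real_normed_field"
  assumes "0 < w 0" and "incseq w" and "(\<Sum>n=0..m. of_real (w n) * y ^ n) = 0"
  shows "norm y \<le> 1"
proof (rule ccontr)
  assume "\<not> norm y \<le> 1"
  then have y: "1 < norm y"
    by simp
  have pos: "0 < w m"
    using assms(1) incseqD[OF assms(2), of 0 m] by simp
  have "w m * norm y ^ Suc m \<le> w m * norm y ^ m"
    using enestroem_kakeya_bound[of w y m] assms y pos
    by (simp add: norm_mult norm_power)
  moreover have "norm y ^ m < norm y ^ Suc m"
    using y by (intro power_strict_increasing) auto
  ultimately show False
    using pos by simp
qed

text \<open>Completing the square: \<open>2 * a * z + b\<close> is a complex square root of the
  positive discriminant, hence real.\<close>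

lemma complex_root_real:
  fixes a b c :: real and z :: complex
  assumes "a \<noteq> 0" and "b\<^sup>2 - 4 * a * c > 0"
    and "of_real a * z\<^sup>2 + of_real b * z + of_real c = 0"
  obtains x where "z = of_real x"
proof -
  define u where "u = 2 * of_real a * z + of_real b"
  have "u\<^sup>2 = 4 * of_real a * (of_real a * z\<^sup>2 + of_real b * z + of_real c) + of_real (b\<^sup>2 - 4 * a * c)"
    unfolding u_def by (simp add: power2_eq_square algebra_simps)
  then have u: "u\<^sup>2 = of_real (b\<^sup>2 - 4 * a * c)"
    using assms(3) by simp
  have "Im (u\<^sup>2) = 0" "Re (u\<^sup>2) > 0"
    using assms(2) unfolding u by simp_all
  \<comment> \<open>The strict inequality excludes \<open>Re u = 0\<close>, so the vanishing product
    forces \<open>Im u = 0\<close>.\<close>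
  then have "Re u * Im u = 0" "(Im u)\<^sup>2 < (Re u)\<^sup>2"
    by (auto simp: power2_eq_square)
  then have "Im u = 0"
    by auto
  then have "Im z = 0"
    using assms(1) by (simp add: u_def)
  then show ?thesis
    using that[of "Re z"] by (simp add: complex_eq_iff)
qed

lemma incseq_geometric_differences:
  fixes w :: "nat \<Rightarrow> real"
  assumes "0 \<le> r" and "w 0 \<le> w 1" and "\<And>n. w (n + 2) - w (n + 1) = r * (w (n + 1) - w n)"
  shows "incseq w"
proof (rule incseq_SucI)
  fix n
  show "w n \<le> w (Suc n)"
  proof (induction n)
    case 0
    then show ?case
      using assms(2) by simp
  next
    case (Suc n)
    then show ?case
      using assms(3)[of n] mult_nonneg_nonneg[OF assms(1), of "w (n + 1) - w n"] by simp
  qed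
qed

theorem theorem3:
  fixes a b c :: real and s :: "nat \<Rightarrow> real" and \<alpha> :: complex
  assumes "a * b * c \<noteq> 0"
    and "(s 0, s 1) \<noteq> (0, 0)"
    and "\<And>n. c * s (n + 2) + b * s (n + 1) + a * s n = 0"
    and "of_real a * \<alpha>\<^sup>2 + of_real b * \<alpha> + of_real c = 0"
    and "\<And>t :: complex. of_real a * t\<^sup>2 + of_real b * t + of_real c = 0 \<Longrightarrow> cmod t \<le> cmod \<alpha>"
    and "a * c > 0"
    and "b\<^sup>2 - 4 * a * c > 0"
    and "s 0 * b * (s 1 * c + b * s 0) > 0"
    and "\<bar>s 0 * c\<bar> > cmod (of_real (s 1 * c + b * s 0) * \<alpha>)"
  shows "\<forall>\<^sub>F m in sequentially. \<forall>z :: complex.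
           (\<Sum>n=0..m. of_real (s n) * z ^ n) = 0 \<longrightarrow> z \<in> cball 0 (\<bar>c\<bar> / cmod (of_real a * \<alpha>))"
proof -
  have nz: "a \<noteq> 0" "b \<noteq> 0" "c \<noteq> 0"
    using assms(1) by auto
  obtain x where \<alpha>: "\<alpha> = of_real x"
    using complex_root_real[OF nz(1) assms(7,4)] .
  have "of_real (a * x\<^sup>2 + b * x + c) = (0 :: complex)"
    using assms(4) by (simp add: \<alpha>)
  then have root: "a * x\<^sup>2 + b * x + c = 0"
    by (simp only: of_real_eq_0_iff)
  then have x: "x \<noteq> 0"
    using nz(3) by auto
  define \<beta> where "\<beta> = c / (a * x)"
  have c: "c = a * x * \<beta>"
    using nz x by (simp add: \<beta>_def)
  \<comment> \<open>Vieta: with \<open>c\<close> eliminated the root equation factors, and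
    cancelling \<open>x\<close> gives the sum of the roots.\<close>
  have "x * (a * x + a * \<beta> + b) = 0"
    using root unfolding c by (simp add: algebra_simps power2_eq_square)
  then have "a * x + a * \<beta> + b = 0"
    using x by (simp only: mult_eq_0_iff) simp
  then have b: "b = - a * (x + \<beta>)"
    by (simp add: algebra_simps)
  have \<beta>: "\<beta> \<noteq> 0"
    using c nz(3) by auto
  have "0 < a\<^sup>2 * (x * \<beta>)"
    using assms(6) unfolding c by (simp add: power2_eq_square algebra_simps)
  then have "0 < x * \<beta>"
    by (simp add: zero_less_mult_iff)
  then have ratio: "0 < \<beta> / x"
    by (auto simp: zero_less_mult_iff zero_less_divide_iff)
  have step: "x * \<beta> * s (n + 2) = (x + \<beta>) * s (n + 1) - s n" for n
  proof -
    have "a * (x * \<beta> * s (n + 2) - (x + \<beta>) * s (n + 1) + s n) = 0"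
      using assms(3)[of n] unfolding b c by (simp add: algebra_simps)
    then show ?thesis
      using nz(1) by simp
  qed
  \<comment> \<open>The factor \<open>s 0\<close> normalises the sign: \<open>w 0\<close> is the
    square of \<open>s 0\<close>.\<close>
  define w where "w n = s 0 * s n * \<beta> ^ n" for n
  have diff: "w (n + 2) - w (n + 1) = \<beta> / x * (w (n + 1) - w n)" for n
  proof -
    have "x * (w (n + 2) - w (n + 1)) = s 0 * \<beta> ^ Suc n * (x * \<beta> * s (n + 2) - x * s (n + 1))"
      by (simp add: w_def algebra_simps)
    also have "\<dots> = \<beta> * (w (n + 1) - w n)"
      unfolding step by (simp add: w_def algebra_simps)
    finally show ?thesis
      using x by (simp add: field_simps)
  qed
  have s0: "s 0 \<noteq> 0"
    using assms(9) by auto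
  \<comment> \<open>This is \<open>(s 1 * c + b * s 0) / a\<close> in terms of the roots. Cancelling
    \<open>\<bar>a * x\<bar>\<close> turns the last hypothesis into
    \<open>\<bar>e\<bar> < \<bar>\<beta> * s 0\<bar>\<close>.\<close>
  define e where "e = x * s 1 * \<beta> - (x + \<beta>) * s 0"
  have "cmod (of_real (s 1 * c + b * s 0) * \<alpha>) = \<bar>a\<bar> * \<bar>x\<bar> * \<bar>e\<bar>"
  proof -
    have "s 1 * c + b * s 0 = a * e"
      unfolding b c e_def by (simp add: algebra_simps)
    then show ?thesis
      by (simp only: \<alpha> norm_mult norm_of_real abs_mult mult_ac)
  qed
  moreover have "\<bar>s 0 * c\<bar> = \<bar>a\<bar> * \<bar>x\<bar> * \<bar>\<beta> * s 0\<bar>"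
    unfolding c by (simp add: abs_mult)
  ultimately have e: "\<bar>e\<bar> < \<bar>\<beta> * s 0\<bar>"
    using assms(9) nz(1) x by simp
  have "0 \<le> w 1 - w 0"
  proof -
    have "w 1 - w 0 = s 0 * (e + \<beta> * s 0) / x"
      using x by (simp add: w_def e_def field_simps)
    \<comment> \<open>Expanding by \<open>\<beta>\<close> makes the denominator positive and puts
      \<open>\<beta> * s 0\<close> in front; \<open>e\<close> is too small to change the sign of
      \<open>e + \<beta> * s 0\<close>, so both factors of the numerator agree in sign.\<close>
    also have "\<dots> = s 0 * \<beta> * (e + \<beta> * s 0) / (x * \<beta>)"
      using \<beta> by simp
    also have "\<dots> \<ge> 0"
    proof (intro divide_nonneg_pos \<open>0 < x * \<beta>\<close>)
      show "0 \<le> s 0 * \<beta> * (e + \<beta> * s 0)"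
        unfolding zero_le_mult_iff[of "s 0 * \<beta>"] using e
        by (simp only: mult.commute[of \<beta>]) linarith
    qed
    finally show ?thesis .
  qed
  then have inc: "incseq w"
    using diff ratio by (intro incseq_geometric_differences[of "\<beta> / x"]) auto
  have pos: "0 < w 0"
    using s0 by (auto simp: w_def zero_less_mult_iff)
  have radius: "\<bar>c\<bar> / cmod (of_real a * \<alpha>) = \<bar>\<beta>\<bar>"
    by (simp add: \<alpha> \<beta>_def norm_mult abs_mult)
  have "cmod z \<le> \<bar>\<beta>\<bar>" if "(\<Sum>n=0..m. of_real (s n) * z ^ n) = 0" for m and z :: complex
  proof -
    \<comment> \<open>The powers of \<open>\<beta>\<close> cancel, so a zero \<open>z\<close> yields
      the zero \<open>z / \<beta>\<close> of the polynomial with coefficients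
      \<open>w n\<close>.\<close>
    have "(\<Sum>n=0..m. of_real (w n) * (z / of_real \<beta>) ^ n)
            = of_real (s 0) * (\<Sum>n=0..m. of_real (s n) * z ^ n)"
      using \<beta> by (simp add: w_def sum_distrib_left power_divide)
    then have "cmod (z / of_real \<beta>) \<le> 1"
      using that by (intro enestroem_kakeya[OF pos inc, of _ m]) simp
    then show ?thesis
      using \<beta> by (simp add: norm_divide field_simps)
  qed
  then show ?thesis
    unfolding radius by (intro always_eventually) (auto simp: dist_norm)
qed

end
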